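(* Let $K$ be a field, let $\alpha\ge2$ be an integer, and let $\mathcal A\subseteq\{0,1,\dots,\alpha\}$ be a set with $0,1,\alpha-1,\alpha\in\mathcal A$. Let $S\subseteq\mathbb N^2$ be the semigroup generated by the elements $(a,\alpha-a)$, $a\in\mathcal A$. Let $$\varepsilon=\max\{i : 0,1,\dots,i,\ \alpha,\alpha-1,\dots,\alpha-i\in\mathcal A\}\ \ (\ge1).$$ Then $$\operatorname{reg}K[S]\le\left[\frac{\lambda(f_{\mathcal A})-1}{\varepsilon}\right]+2,$$ where $[a]$ denotes the integer part (floor) of $a\in\mathbb R$.
   Context: $\mathbb N$ denotes the set of non-negative integers. $K[S]\subseteq K[t_1,t_2]$ is the affine semigroup ring spanned over $K$ by the monomials $t_1^{u_1}t_2^{u_2}$ with $(u_1,u_2)\in S$, where $S$ contains $0$; it is graded by $\deg(u_1,u_2)=(u_1+u_2)/\alpha$. Let $\mathfrak m$ be its maximal homogeneous ideal. The Castelnuovo-Mumford regularity $\operatorname{reg}K[S]$ is the smallest integer $n$ such that $H^i_{\mathfrak m}(K[S])_{j-i}=0$ for all $i\ge0$ and all $j>n$. $f_{\mathcal A}=\sum_{i\in\mathcal A}t^i$ is the polynomial with coefficients in $\{0,1\}$ and support $\mathcal A$. A gap of $f_{\mathcal A}$ is a set $L=\{i,i+1,\dots,j\}\subseteq\mathbb N\setminus\mathcal A$ with $i\le j$ and $i-1,j+1\in\mathcal A$; its length is its cardinality. $\lambda(f_{\mathcal A})$ denotes the maximal length of a gap of $f_{\mathcal A}$ ($0$ if there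 is no gap). *)

theory Defs
  imports
    "HOL-Library.Poly_Mapping"
    "HOL-Library.Product_Plus"
    "HOL-Computational_Algebra.Polynomial"
begin

section \<open>Local cohomology via the Cech complex\<close>

text \<open>
  Let R be a subring of a commutative ring T (the type \<open>'r\<close>), let X be a finite linearly
  ordered index set, and let the elements \<open>x j\<close> of R, for j in X, be invertible in T.
  The local cohomology of R with support in the ideal generated by the family x is the cohomology
  of the (extended) Cech complex
    0 -> R -> (+)_j R_{x_j} -> (+)_{j<k} R_{x_j x_k} -> ... -> R_{x_1 ... x_n} -> 0,
  in which the localisations are realised inside T and the maps are alternating sums of
  inclusions.
\<close>

definition localization :: "'r::comm_ring_1 set \<Rightarrow> 'r \<Rightarrow> 'r set" where
  "localization R s = {y. \<exists>k::nat. s ^ k * y \<in> R}"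

text \<open>A cochain of degree i assigns to each i-element subset F of X an element of the
  localisation of R at the product of the \<open>x j\<close>, j in F (so degree 0 is R itself), and is extended
  by 0 to all other sets.\<close>

definition cech_cochains ::
    "'r::comm_ring_1 set \<Rightarrow> ('i::linorder \<Rightarrow> 'r) \<Rightarrow> 'i set \<Rightarrow> nat \<Rightarrow> ('i set \<Rightarrow> 'r) set" where
  "cech_cochains R x X i =
     {c. \<forall>F. if F \<subseteq> X \<and> card F = i then c F \<in> localization R (\<Prod>j\<in>F. x j) else c F = 0}"

definition cech_diff :: "'i::linorder set \<Rightarrow> ('i set \<Rightarrow> 'r::comm_ring_1) \<Rightarrow> 'i set \<Rightarrow> 'r" where
  "cech_diff X c F =
     (if F \<subseteq> X then \<Sum>j\<in>F. (- 1) ^ card {k\<in>F. k < j} * c (F - {j}) else 0)"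

definition cech_cocycles ::
    "'r::comm_ring_1 set \<Rightarrow> ('i::linorder \<Rightarrow> 'r) \<Rightarrow> 'i set \<Rightarrow> nat \<Rightarrow> ('i set \<Rightarrow> 'r) set" where
  "cech_cocycles R x X i = {c \<in> cech_cochains R x X i. cech_diff X c = (\<lambda>F. 0)}"

fun cech_coboundaries ::
    "'r::comm_ring_1 set \<Rightarrow> ('i::linorder \<Rightarrow> 'r) \<Rightarrow> 'i set \<Rightarrow> nat \<Rightarrow> ('i set \<Rightarrow> 'r) set" where
  "cech_coboundaries R x X 0 = {\<lambda>F. 0}"
| "cech_coboundaries R x X (Suc i) = cech_diff X ` cech_cochains R x X i"

definition cohomologous ::
    "'r::comm_ring_1 set \<Rightarrow> ('i::linorder \<Rightarrow> 'r) \<Rightarrow> 'i set \<Rightarrow> nat \<Rightarrow> (('i set \<Rightarrow> 'r) \<times> ('i set \<Rightarrow> 'r)) set" where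
  "cohomologous R x X i =
     {(z, w). z \<in> cech_cocycles R x X i \<and> w \<in> cech_cocycles R x X i \<and>
              (\<lambda>F. z F - w F) \<in> cech_coboundaries R x X i}"

definition local_cohomology ::
    "'r::comm_ring_1 set \<Rightarrow> ('i::linorder \<Rightarrow> 'r) \<Rightarrow> 'i set \<Rightarrow> nat \<Rightarrow> ('i set \<Rightarrow> 'r) set set" where
  "local_cohomology R x X i = cech_cocycles R x X i // cohomologous R x X i"

text \<open>For a grading of T with component \<open>grd d\<close> in degree d, the degree d component of the local
  cohomology consists of the classes of cocycles all of whose values are homogeneous of
  degree d. A component is zero if it consists of the class of the zero cocycle only.\<close>

definition local_cohomology_component ::
    "(int \<Rightarrow> 'r::comm_ring_1 set) \<Rightarrow> 'r set \<Rightarrow> ('i::linorder \<Rightarrow> 'r) \<Rightarrow> 'i set \<Rightarrow> nat \<Rightarrow> int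
      \<Rightarrow> ('i set \<Rightarrow> 'r) set set" where
  "local_cohomology_component grd R x X i d =
     {H \<in> local_cohomology R x X i. \<exists>z\<in>H. \<forall>F. z F \<in> grd d}"

definition regularity ::
    "(int \<Rightarrow> 'r::comm_ring_1 set) \<Rightarrow> 'r set \<Rightarrow> ('i::linorder \<Rightarrow> 'r) \<Rightarrow> 'i set \<Rightarrow> int" where
  "regularity grd R x X =
     (LEAST n. \<forall>(i::nat) (j::int). n < j \<longrightarrow>
        local_cohomology_component grd R x X i (j - int i) = {cohomologous R x X i `` {\<lambda>F. 0}})"


section \<open>The affine semigroup ring\<close>

inductive_set affine_semigroup :: "nat \<Rightarrow> nat set \<Rightarrow> (nat \<times> nat) set" for \<alpha> :: nat and A :: "nat set" where
  zero: "0 \<in> affine_semigroup \<alpha> A"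
| add: "s \<in> affine_semigroup \<alpha> A \<Longrightarrow> a \<in> A \<Longrightarrow> s + (a, \<alpha> - a) \<in> affine_semigroup \<alpha> A"

text \<open>The type \<open>(int \<times> int) \<Rightarrow>\<^sub>0 'k\<close> is the ring of Laurent polynomials in t1, t2 over
  the field \<open>'k\<close>. It contains K[t1, t2], and all monomials are invertible in it, so that it
  can serve as the ambient ring T above.\<close>

definition semigroup_ring :: "(nat \<times> nat) set \<Rightarrow> ((int \<times> int) \<Rightarrow>\<^sub>0 'k::field) set" where
  "semigroup_ring S = {f. Poly_Mapping.keys f \<subseteq> map_prod int int ` S}"

definition homogeneous :: "nat \<Rightarrow> int \<Rightarrow> ((int \<times> int) \<Rightarrow>\<^sub>0 'k::field) set" where
  "homogeneous \<alpha> d = {f. \<forall>u\<in>Poly_Mapping.keys f. fst u + snd u = d * int \<alpha>}"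

definition gen :: "nat \<Rightarrow> nat \<Rightarrow> (int \<times> int) \<Rightarrow>\<^sub>0 'k::field" where
  "gen \<alpha> a = Poly_Mapping.single (int a, int (\<alpha> - a)) 1"

definition max_hom_ideal :: "(nat \<times> nat) set \<Rightarrow> ((int \<times> int) \<Rightarrow>\<^sub>0 'k::field) set" where
  "max_hom_ideal S = {f \<in> semigroup_ring S. Poly_Mapping.lookup f 0 = 0}"

lemma gen_unit: "gen \<alpha> a * Poly_Mapping.single (- int a, - int (\<alpha> - a)) 1 = 1"
  by (simp add: gen_def mult_single zero_prod_def[symmetric])

lemma mult_gen_in_max_hom_ideal:
  fixes f :: "(int \<times> int) \<Rightarrow>\<^sub>0 'k::field"
  assumes "f \<in> semigroup_ring (affine_semigroup \<alpha> A)" "a \<in> A" "0 < \<alpha>"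
  shows "f * gen \<alpha> a \<in> max_hom_ideal (affine_semigroup \<alpha> A)"
proof -
  have *: "u \<in> map_prod int int ` affine_semigroup \<alpha> A \<and> u \<noteq> 0"
    if u: "u \<in> Poly_Mapping.keys (f * gen \<alpha> a)" for u
  proof -
    have "u \<in> {v + w | v w. v \<in> Poly_Mapping.keys f \<and> w \<in> Poly_Mapping.keys (gen \<alpha> a :: _ \<Rightarrow>\<^sub>0 'k)}"
      by (rule subsetD[OF keys_mult u])
    then obtain v where v: "v \<in> Poly_Mapping.keys f" "u = v + (int a, int (\<alpha> - a))"
      by (auto simp: gen_def)
    have "v \<in> map_prod int int ` affine_semigroup \<alpha> A"
      using assms(1) v(1) by (simp add: semigroup_ring_def subset_iff del: split_paired_All)
    then obtain s where s: "s \<in> affine_semigroup \<alpha> A" "v = map_prod int int s"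
      by (rule imageE)
    have "u = map_prod int int (s + (a, \<alpha> - a))"
      using v(2) s(2) by (cases s) simp
    moreover have "map_prod int int (s + (a, \<alpha> - a)) \<noteq> 0"
      using \<open>0 < \<alpha>\<close> by (cases s) (auto simp: zero_prod_def)
    ultimately show ?thesis
      using affine_semigroup.add[OF s(1) assms(2)] by simp
  qed
  then have "0 \<notin> Poly_Mapping.keys (f * gen \<alpha> a)"
    by blast
  moreover have "Poly_Mapping.keys (f * gen \<alpha> a) \<subseteq> map_prod int int ` affine_semigroup \<alpha> A"
    using * by blast
  ultimately show ?thesis
    by (simp add: max_hom_ideal_def semigroup_ring_def in_keys_iff)
qed

text \<open>The maximal homogeneous ideal is generated by the monomials \<open>gen \<alpha> a\<close>, so that the
  Cech complex on these elements computes the local cohomology with support in it.\<close>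

lemma max_hom_ideal_generated:
  assumes "finite A" "0 < \<alpha>"
  shows "max_hom_ideal (affine_semigroup \<alpha> A) =
    {\<Sum>a\<in>A. r a * gen \<alpha> a | r. \<forall>a\<in>A. r a \<in> (semigroup_ring (affine_semigroup \<alpha> A) :: (_ \<Rightarrow>\<^sub>0 'k::field) set)}"
    (is "?L = ?R")
proof
  show "?R \<subseteq> ?L"
  proof clarify
    fix r :: "nat \<Rightarrow> (int \<times> int) \<Rightarrow>\<^sub>0 'k"
    assume r: "\<forall>a\<in>A. r a \<in> semigroup_ring (affine_semigroup \<alpha> A)"
    let ?S = "map_prod int int ` affine_semigroup \<alpha> A"
    have t: "Poly_Mapping.keys (r a * gen \<alpha> a) \<subseteq> ?S - {0}" if "a \<in> A" for a
    proof -
      have "r a * gen \<alpha> a \<in> max_hom_ideal (affine_semigroup \<alpha> A)"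
        using mult_gen_in_max_hom_ideal r assms(2) that by blast
      then have "Poly_Mapping.keys (r a * gen \<alpha> a) \<subseteq> ?S" "0 \<notin> Poly_Mapping.keys (r a * gen \<alpha> a)"
        by (simp_all only: max_hom_ideal_def semigroup_ring_def in_keys_iff mem_Collect_eq not_not)
      then show ?thesis by blast
    qed
    have "Poly_Mapping.keys (\<Sum>a\<in>A. r a * gen \<alpha> a) \<subseteq> ?S - {0}"
      using keys_sum[of "\<lambda>a. r a * gen \<alpha> a" A] t by blast
    then have "Poly_Mapping.keys (\<Sum>a\<in>A. r a * gen \<alpha> a) \<subseteq> ?S"
        "0 \<notin> Poly_Mapping.keys (\<Sum>a\<in>A. r a * gen \<alpha> a)"
      by blast+
    then show "(\<Sum>a\<in>A. r a * gen \<alpha> a) \<in> ?L"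
      by (simp only: max_hom_ideal_def semigroup_ring_def in_keys_iff mem_Collect_eq not_not)
  qed
next
  show "?L \<subseteq> ?R"
  proof
    fix f :: "(int \<times> int) \<Rightarrow>\<^sub>0 'k"
    assume f: "f \<in> ?L"
    let ?S = "map_prod int int ` affine_semigroup \<alpha> A"
    have "\<exists>a v. a \<in> A \<and> v \<in> ?S \<and> u = v + (int a, int (\<alpha> - a))" if u: "u \<in> Poly_Mapping.keys f" for u
    proof -
      obtain s where s: "s \<in> affine_semigroup \<alpha> A" "u = map_prod int int s"
        using f u by (auto simp: max_hom_ideal_def semigroup_ring_def)
      have "u \<noteq> 0"
        using f u by (auto simp: max_hom_ideal_def in_keys_iff)
      from s(1) show ?thesis
      proof cases
        case zero
        with s \<open>u \<noteq> 0\<close> show ?thesis by (simp add: zero_prod_def)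
      next
        case (add s' a)
        then have "u = map_prod int int s' + (int a, int (\<alpha> - a))"
          using s by (cases s') auto
        with add show ?thesis by blast
      qed
    qed
    then obtain g v where gv: "\<And>u. u \<in> Poly_Mapping.keys f \<Longrightarrow>
        g u \<in> A \<and> v u \<in> ?S \<and> u = v u + (int (g u), int (\<alpha> - g u))"
      by metis
    define r where "r a = (\<Sum>u\<in>{u\<in>Poly_Mapping.keys f. g u = a}.
        Poly_Mapping.single (v u) (Poly_Mapping.lookup f u))" for a
    have "r a \<in> semigroup_ring (affine_semigroup \<alpha> A)" for a
    proof -
      have "Poly_Mapping.keys (r a) \<subseteq> (\<Union>u\<in>{u\<in>Poly_Mapping.keys f. g u = a}.
          Poly_Mapping.keys (Poly_Mapping.single (v u) (Poly_Mapping.lookup f u)))"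
        unfolding r_def by (rule keys_sum)
      also have "\<dots> \<subseteq> ?S"
        using gv by auto
      finally show ?thesis by (simp add: semigroup_ring_def)
    qed
    moreover have "f = (\<Sum>a\<in>A. r a * gen \<alpha> a)"
    proof -
      have "(\<Sum>a\<in>A. r a * gen \<alpha> a) = (\<Sum>a\<in>A. \<Sum>u\<in>{u\<in>Poly_Mapping.keys f. g u = a}.
          Poly_Mapping.single u (Poly_Mapping.lookup f u))"
        unfolding r_def sum_distrib_right
        using gv by (intro sum.cong refl) (auto simp: gen_def mult_single)
      also have "\<dots> = (\<Sum>u\<in>Poly_Mapping.keys f. Poly_Mapping.single u (Poly_Mapping.lookup f u))"
        using gv assms by (intro sum.group) auto
      also have "\<dots> = f"
        by (rule poly_mapping_eqI)
          (auto simp: lookup_sum lookup_single when_def in_keys_iff)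
      finally show ?thesis by simp
    qed
    ultimately show "f \<in> ?R" by blast
  qed
qed

definition reg_semigroup_ring :: "'k::field itself \<Rightarrow> nat \<Rightarrow> nat set \<Rightarrow> int" where
  "reg_semigroup_ring _ \<alpha> A =
     regularity (homogeneous \<alpha>)
       (semigroup_ring (affine_semigroup \<alpha> A) :: ((int \<times> int) \<Rightarrow>\<^sub>0 'k) set) (gen \<alpha>) A"


section \<open>Gaps\<close>

definition support_poly :: "nat set \<Rightarrow> int poly" where
  "support_poly A = (\<Sum>i\<in>A. monom 1 i)"

definition gaps :: "'a::zero poly \<Rightarrow> nat set set" where
  "gaps f = {{i..j} | i j. i \<le> j \<and> (\<forall>k\<in>{i..j}. coeff f k = 0) \<and>
                       1 \<le> i \<and> coeff f (i - 1) \<noteq> 0 \<and> coeff f (j + 1) \<noteq> 0}"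

definition max_gap :: "'a::zero poly \<Rightarrow> nat" where
  "max_gap f = Max (insert 0 (card ` gaps f))"

definition eps :: "nat \<Rightarrow> nat set \<Rightarrow> nat" where
  "eps \<alpha> A = Max {i. i \<le> \<alpha> \<and> (\<forall>k\<le>i. k \<in> A \<and> \<alpha> - k \<in> A)}"

end

theory Submission
  imports Defs
begin

text \<open>
  The Cech complex splits into strands indexed by the monomials \<open>u = (x, y)\<close> with \<open>\<alpha>\<close> dividing \<open>x + y\<close>.
  As \<open>1\<close> and \<open>\<alpha> - 1\<close> lie in \<open>A\<close>, the strand of \<open>u\<close> sees the set \<open>{\<alpha>}\<close> iff \<open>y \<ge> 0\<close>, the set \<open>{0}\<close>
  iff \<open>x \<ge> 0\<close>, the empty set iff \<open>u\<close> is in the semigroup, and all other sets always. Hence only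
  \<open>H\<^sup>1\<close>, given by the holes of the semigroup in the quadrant, and \<open>H\<^sup>2\<close>, given by \<open>x, y < 0\<close>, are
  nonzero. The latter lives in degrees at most \<open>-1\<close>, and the semigroup has no hole in degree \<open>d \<ge> 1\<close> once
  \<open>(d - 1) * \<epsilon>\<close> is at least the maximal gap length.
\<close>

section \<open>Filling the semigroup in high degrees\<close>

lemma coeff_support_poly: "finite A \<Longrightarrow> coeff (support_poly A) k = (if k \<in> A then 1 else 0)"
  by (simp add: support_poly_def coeff_sum)

lemma gap_length_le_max_gap:
  assumes "A \<subseteq> {0..\<alpha>}" "l \<in> A" "r \<in> A" "l + 1 < r" "\<And>k. l < k \<Longrightarrow> k < r \<Longrightarrow> k \<notin> A"
  shows "r - l - 1 \<le> max_gap (support_poly A)"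
proof -
  have fin: "finite A" using assms(1) finite_subset by blast
  let ?f = "support_poly A"
  have "gaps ?f \<subseteq> Pow {0..\<alpha>}"
  proof
    fix L assume "L \<in> gaps ?f"
    then obtain i j where "L = {i..j}" "coeff ?f (j + 1) \<noteq> 0"
      by (auto simp: gaps_def)
    then show "L \<in> Pow {0..\<alpha>}"
      using assms(1) by (auto simp: coeff_support_poly[OF fin] split: if_splits)
  qed
  then have finite: "finite (insert 0 (card ` gaps ?f))"
    by (meson finite.insertI finite_Pow_iff finite_atLeastAtMost finite_imageI finite_subset)
  have "{l + 1..r - 1} \<in> gaps ?f"
    unfolding gaps_def mem_Collect_eq
    using assms(2-5) by (intro exI[of _ "l + 1"] exI[of _ "r - 1"]) (auto simp: coeff_support_poly[OF fin])
  then have "card {l + 1..r - 1} \<in> insert 0 (card ` gaps ?f)" by blast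
  then have "card {l + 1..r - 1} \<le> max_gap ?f"
    unfolding max_gap_def using finite by (rule Max_ge[rotated])
  then show ?thesis using assms(4) by simp
qed

lemma window_meets_support:
  assumes A: "A \<subseteq> {0..\<alpha>}" and "0 \<in> A" "\<alpha> \<in> A" and y: "y \<le> \<alpha>"
    and w: "max_gap (support_poly A) \<le> p + q"
  shows "\<exists>a\<in>A. a \<le> y + p \<and> y \<le> a + q"
proof (rule ccontr)
  assume neg: "\<not> ?thesis"
  have fin: "finite A" using A finite_subset by blast
  have "y \<notin> A" using neg by auto
  define l where "l = Max {a \<in> A. a < y}"
  define r where "r = Min {a \<in> A. y < a}"
  have "0 \<in> {a \<in> A. a < y}" "\<alpha> \<in> {a \<in> A. y < a}"
    using assms \<open>y \<notin> A\<close> by (auto intro: le_neq_trans gr0I)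
  then have ne: "{a \<in> A. a < y} \<noteq> {}" "{a \<in> A. y < a} \<noteq> {}" by blast+
  have fins: "finite {a \<in> A. a < y}" "finite {a \<in> A. y < a}" using fin by simp_all
  have l: "l \<in> {a \<in> A. a < y}" and r: "r \<in> {a \<in> A. y < a}"
    unfolding l_def r_def by (rule Max_in[OF fins(1) ne(1)], rule Min_in[OF fins(2) ne(2)])
  have "k \<notin> A" if "l < k" "k < r" for k
  proof
    assume "k \<in> A"
    then have "k < y \<or> y < k" using \<open>y \<notin> A\<close> by (metis linorder_neqE_nat)
    then show False
    proof
      assume "k < y"
      then have "k \<le> l" unfolding l_def using \<open>k \<in> A\<close> fins(1) by (intro Max_ge) auto
      then show False using that by simp
    next
      assume "y < k"
      then have "r \<le> k" unfolding r_def using \<open>k \<in> A\<close> fins(2) by (intro Min_le) auto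
      then show False using that by simp
    qed
  qed
  then have "r - l - 1 \<le> p + q"
    using gap_length_le_max_gap[OF A, of l r] l r w by fastforce
  moreover have "y + p < r" "l + q < y"
    using neg l r by auto
  ultimately show False by linarith
qed

lemma affine_semigroup_add_low:
  assumes "\<And>k. k \<le> e \<Longrightarrow> k \<in> A" "e \<le> \<alpha>" "s \<in> affine_semigroup \<alpha> A" "t \<le> m * e"
  shows "s + (t, m * \<alpha> - t) \<in> affine_semigroup \<alpha> A"
  using assms(4)
proof (induction m arbitrary: t)
  case 0
  then show ?case using assms(3) by (simp add: zero_prod_def[symmetric])
next
  case (Suc m)
  define a where "a = min t e"
  have ta: "t - a \<le> m * e" using Suc.prems by (auto simp: a_def)
  moreover have "m * e \<le> m * \<alpha>" using assms(2) by simp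
  moreover have a: "a \<le> t" "a \<le> \<alpha>" using assms(2) by (auto simp: a_def)
  ultimately have "Suc m * \<alpha> - t = m * \<alpha> - (t - a) + (\<alpha> - a)"
    unfolding mult_Suc by linarith
  then have "s + (t, Suc m * \<alpha> - t) = s + (t - a, m * \<alpha> - (t - a)) + (a, \<alpha> - a)"
    using a by (cases s) simp
  then show ?case
    using affine_semigroup.add[OF Suc.IH[OF ta], of a] assms(1)[of a] by (simp add: a_def)
qed

lemma affine_semigroup_add_high:
  assumes "\<And>k. k \<le> e \<Longrightarrow> \<alpha> - k \<in> A" "e \<le> \<alpha>" "s \<in> affine_semigroup \<alpha> A" "t \<le> m * e"
  shows "s + (m * \<alpha> - t, t) \<in> affine_semigroup \<alpha> A"
  using assms(4)
proof (induction m arbitrary: t)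
  case 0
  then show ?case using assms(3) by (simp add: zero_prod_def[symmetric])
next
  case (Suc m)
  define a where "a = min t e"
  have ta: "t - a \<le> m * e" using Suc.prems by (auto simp: a_def)
  moreover have "m * e \<le> m * \<alpha>" using assms(2) by simp
  moreover have a: "a \<le> t" "a \<le> \<alpha>" using assms(2) by (auto simp: a_def)
  ultimately have "Suc m * \<alpha> - t = m * \<alpha> - (t - a) + (\<alpha> - a)"
    unfolding mult_Suc by linarith
  then have "s + (Suc m * \<alpha> - t, t) = s + (m * \<alpha> - (t - a), t - a) + (\<alpha> - a, \<alpha> - (\<alpha> - a))"
    using a by (cases s) simp
  then show ?case
    using affine_semigroup.add[OF Suc.IH[OF ta], of "\<alpha> - a"] assms(1)[of a] by (simp add: a_def)
qed

lemma eps_props: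
  assumes "2 \<le> \<alpha>" "0 \<in> A" "1 \<in> A" "\<alpha> - 1 \<in> A" "\<alpha> \<in> A"
  shows "1 \<le> eps \<alpha> A" "eps \<alpha> A \<le> \<alpha>"
    "k \<le> eps \<alpha> A \<Longrightarrow> k \<in> A" "k \<le> eps \<alpha> A \<Longrightarrow> \<alpha> - k \<in> A"
proof -
  let ?E = "{i. i \<le> \<alpha> \<and> (\<forall>k\<le>i. k \<in> A \<and> \<alpha> - k \<in> A)}"
  have fin: "finite ?E" by simp
  have one: "1 \<in> ?E" using assms by (auto simp: le_Suc_eq)
  then show "1 \<le> eps \<alpha> A"
    unfolding eps_def using fin by (rule Max_ge[rotated])
  have "eps \<alpha> A \<in> ?E"
    unfolding eps_def using fin one by (intro Max_in) blast+
  then show "eps \<alpha> A \<le> \<alpha>" "k \<le> eps \<alpha> A \<Longrightarrow> k \<in> A" "k \<le> eps \<alpha> A \<Longrightarrow> \<alpha> - k \<in> A"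
    by auto
qed

text \<open>Adding \<open>d - 1\<close> elements of the two end intervals \<open>{0..\<epsilon>}\<close> and \<open>{\<alpha>-\<epsilon>..\<alpha>}\<close>,
  \<open>m\<close> of them from the second, yields an interval of length \<open>(d - 1) * \<epsilon>\<close>, which is long enough
  to bridge every gap of \<open>A\<close>.\<close>

lemma affine_semigroup_full_degree:
  assumes "2 \<le> \<alpha>" and A: "A \<subseteq> {0..\<alpha>}" "0 \<in> A" "1 \<in> A" "\<alpha> - 1 \<in> A" "\<alpha> \<in> A"
    and d: "1 \<le> d" "max_gap (support_poly A) \<le> (d - 1) * eps \<alpha> A"
    and xy: "x + y = d * \<alpha>"
  shows "(x, y) \<in> affine_semigroup \<alpha> A"
proof -
  let ?S = "affine_semigroup \<alpha> A" and ?e = "eps \<alpha> A"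
  note e = eps_props[OF assms(1) A(2-5)]
  define m where "m = min (x div \<alpha>) (d - 1)"
  define n where "n = d - 1 - m"
  have m: "m * \<alpha> \<le> x"
    using div_times_less_eq_dividend[of x \<alpha>] mult_le_mono1[of m "x div \<alpha>" \<alpha>] unfolding m_def
    by (meson le_trans min.cobounded1)
  have dmn: "d = m + n + 1" using d(1) by (simp add: m_def n_def)
  have "x \<le> (m + 1) * \<alpha>"
  proof (cases "x div \<alpha> \<le> d - 1")
    case True
    then have "m = x div \<alpha>" by (simp add: m_def)
    then show ?thesis
      using dividend_less_div_times[of \<alpha> x] assms(1) by (simp add: add.commute)
  next
    case False
    then have "m + 1 = d" using d(1) by (simp add: m_def)
    then show ?thesis using xy by simp
  qed
  then obtain w where w: "x = m * \<alpha> + w" "w \<le> \<alpha>"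
    using m by (metis add.commute le_Suc_ex mult.commute mult_Suc_right nat_add_left_cancel_le Suc_eq_plus1)
  have y: "y + w = n * \<alpha> + \<alpha>"
    using xy w unfolding dmn by (simp add: algebra_simps)
  have "max_gap (support_poly A) \<le> m * ?e + n * ?e"
    using d(2) unfolding dmn by (simp add: algebra_simps)
  then obtain a where a: "a \<in> A" "a \<le> w + m * ?e" "w \<le> a + n * ?e"
    using window_meets_support[OF A(1,2,5) w(2)] by blast
  have "a \<le> \<alpha>" using a(1) A(1) by auto
  have "0 + (a, \<alpha> - a) \<in> ?S"
    using a(1) by (intro affine_semigroup.intros)
  then have start: "(a, \<alpha> - a) \<in> ?S" by simp
  have nm: "n * ?e \<le> n * \<alpha>" "m * ?e \<le> m * \<alpha>" using e(2) by simp_all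
  show ?thesis
  proof (cases "a \<le> w")
    case True
    have "(a, \<alpha> - a) + (w - a, n * \<alpha> - (w - a)) + (m * \<alpha> - 0, 0) \<in> ?S"
      using start True a(3)
      by (intro affine_semigroup_add_high[where e = ?e] affine_semigroup_add_low[where e = ?e] e) auto
    moreover have "(a, \<alpha> - a) + (w - a, n * \<alpha> - (w - a)) + (m * \<alpha> - 0, 0) = (x, y)"
      using True a(3) w y nm \<open>a \<le> \<alpha>\<close> unfolding add_Pair prod.inject by linarith
    ultimately show ?thesis by simp
  next
    case False
    have "(a, \<alpha> - a) + (0, n * \<alpha> - 0) + (m * \<alpha> - (a - w), a - w) \<in> ?S"
      using start False a(2)
      by (intro affine_semigroup_add_high[where e = ?e] affine_semigroup_add_low[where e = ?e] e) auto
    moreover have "(a, \<alpha> - a) + (0, n * \<alpha> - 0) + (m * \<alpha> - (a - w), a - w) = (x, y)"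
      using False a(2) w y nm \<open>a \<le> \<alpha>\<close> unfolding add_Pair prod.inject by linarith
    ultimately show ?thesis by simp
  qed
qed


section \<open>Localisations of the semigroup ring\<close>

lemma keys_single_one_times:
  fixes y :: "'a::ab_group_add \<Rightarrow>\<^sub>0 'k::comm_ring_1"
  shows "Poly_Mapping.keys (Poly_Mapping.single a 1 * y) = (+) a ` Poly_Mapping.keys y"
proof -
  have sub: "Poly_Mapping.keys (Poly_Mapping.single b 1 * f) \<subseteq> (+) b ` Poly_Mapping.keys f"
    for b and f :: "'a \<Rightarrow>\<^sub>0 'k"
    using keys_mult[of "Poly_Mapping.single b 1" f] by (fastforce split: if_splits)
  have "Poly_Mapping.single (- a) 1 * (Poly_Mapping.single a 1 * y) = y"
    by (simp add: mult.assoc[symmetric] mult_single)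
  then have "Poly_Mapping.keys y \<subseteq> (+) (- a) ` Poly_Mapping.keys (Poly_Mapping.single a 1 * y)"
    using sub[of "- a" "Poly_Mapping.single a 1 * y"] by simp
  then have "(+) a ` Poly_Mapping.keys y \<subseteq> Poly_Mapping.keys (Poly_Mapping.single a 1 * y)"
    by (auto simp: image_iff subset_iff)
  with sub show ?thesis by blast
qed

lemma prod_single:
  "(\<Prod>j\<in>F. Poly_Mapping.single (g j) (1::'k::comm_semiring_1)) = Poly_Mapping.single (\<Sum>j\<in>F. g j) 1"
  by (induction F rule: infinite_finite_induct) (simp_all add: mult_single)

lemma single_power:
  "Poly_Mapping.single (a, b) (1::'k::comm_semiring_1) ^ k
    = Poly_Mapping.single (int k * a, int k * b) 1"
  by (induction k) (simp_all add: mult_single algebra_simps zero_prod_def[symmetric])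

lemma prod_gen_power:
  "(\<Prod>j\<in>F. gen \<alpha> j :: (int \<times> int) \<Rightarrow>\<^sub>0 'k::field) ^ k =
     Poly_Mapping.single (int (k * (\<Sum>j\<in>F. j)), int (k * (\<Sum>j\<in>F. \<alpha> - j))) 1"
proof -
  have "(\<Sum>j\<in>F. (int j, int (\<alpha> - j))) = (int (\<Sum>j\<in>F. j), int (\<Sum>j\<in>F. \<alpha> - j))"
    by (induction F rule: infinite_finite_induct) (simp_all add: zero_prod_def)
  then show ?thesis
    by (simp add: gen_def prod_single single_power)
qed

lemma affine_semigroup_plus:
  assumes "s \<in> affine_semigroup \<alpha> A" "t \<in> affine_semigroup \<alpha> A"
  shows "s + t \<in> affine_semigroup \<alpha> A"
  using assms(2)
proof induction
  case (add u a)
  then show ?case using affine_semigroup.add[of "s + u" \<alpha> A a] by (simp add: add.assoc)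
qed (simp add: assms(1))

lemma sum_generators_in_affine_semigroup:
  "F \<subseteq> A \<Longrightarrow> (k * (\<Sum>j\<in>F. j), k * (\<Sum>j\<in>F. \<alpha> - j)) \<in> affine_semigroup \<alpha> A"
proof (induction k)
  case 0
  show ?case using affine_semigroup.zero by (simp add: zero_prod_def)
next
  case (Suc k)
  have "(\<Sum>j\<in>F. j, \<Sum>j\<in>F. \<alpha> - j) \<in> affine_semigroup \<alpha> A"
    using Suc.prems
  proof (induction F rule: infinite_finite_induct)
    case (insert a F)
    then have "(\<Sum>j\<in>F. j, \<Sum>j\<in>F. \<alpha> - j) + (a, \<alpha> - a) \<in> affine_semigroup \<alpha> A"
      by (intro affine_semigroup.add) auto
    then show ?case using insert.hyps by (simp add: add.commute)
  qed (use affine_semigroup.zero in \<open>simp_all add: zero_prod_def\<close>)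
  from affine_semigroup_plus[OF Suc.IH[OF Suc.prems] this] show ?case
    by (simp add: add.commute)
qed

lemma localization_iff:
  fixes f :: "(int \<times> int) \<Rightarrow>\<^sub>0 'k::field"
  assumes "F \<subseteq> A"
  shows "f \<in> localization (semigroup_ring (affine_semigroup \<alpha> A)) (\<Prod>j\<in>F. gen \<alpha> j) \<longleftrightarrow>
    (\<forall>u\<in>Poly_Mapping.keys f. \<exists>k. (int (k * (\<Sum>j\<in>F. j)), int (k * (\<Sum>j\<in>F. \<alpha> - j))) + u
        \<in> map_prod int int ` affine_semigroup \<alpha> A)"
    (is "?L \<longleftrightarrow> (\<forall>u\<in>_. \<exists>k. ?s k + u \<in> ?S)")
proof
  assume ?L
  then obtain k where "(\<Prod>j\<in>F. gen \<alpha> j) ^ k * f \<in> semigroup_ring (affine_semigroup \<alpha> A)"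
    by (auto simp: localization_def)
  then have "(+) (?s k) ` Poly_Mapping.keys f \<subseteq> ?S"
    by (simp only: prod_gen_power semigroup_ring_def keys_single_one_times mem_Collect_eq)
  then show "\<forall>u\<in>Poly_Mapping.keys f. \<exists>k. ?s k + u \<in> ?S"
    unfolding image_subset_iff by (intro ballI exI[of _ k]) (rule bspec)
next
  assume "\<forall>u\<in>Poly_Mapping.keys f. \<exists>k. ?s k + u \<in> ?S"
  then obtain k where k: "\<And>u. u \<in> Poly_Mapping.keys f \<Longrightarrow> ?s (k u) + u \<in> ?S"
    by metis
  define K where "K = Max (insert 0 (k ` Poly_Mapping.keys f))"
  have "?s K + u \<in> ?S" if u: "u \<in> Poly_Mapping.keys f" for u
  proof -
    have "k u \<le> K"
      using u by (simp add: K_def)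
    then obtain n where n: "K = n + k u" by (metis add.commute le_Suc_ex)
    obtain s where s: "s \<in> affine_semigroup \<alpha> A" "?s (k u) + u = map_prod int int s"
      using k[OF u] by (rule imageE)
    have "?s K + u = ?s n + map_prod int int s"
      unfolding s(2)[symmetric] n by (cases u) (simp add: algebra_simps)
    also have "\<dots> = map_prod int int ((n * (\<Sum>j\<in>F. j), n * (\<Sum>j\<in>F. \<alpha> - j)) + s)"
      by (cases s) simp
    finally have eq: "?s K + u = \<dots>" .
    show ?thesis
      unfolding eq
      by (intro imageI affine_semigroup_plus[OF sum_generators_in_affine_semigroup[OF assms] s(1)])
  qed
  then have "(+) (?s K) ` Poly_Mapping.keys f \<subseteq> ?S"
    by (simp only: image_subset_iff) simp
  then have "(\<Prod>j\<in>F. gen \<alpha> j) ^ K * f \<in> semigroup_ring (affine_semigroup \<alpha> A)"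
    by (simp only: prod_gen_power semigroup_ring_def keys_single_one_times mem_Collect_eq)
  then show ?L
    by (auto simp: localization_def)
qed

lemma in_localization:
  fixes f :: "(int \<times> int) \<Rightarrow>\<^sub>0 'k::field"
  assumes "2 \<le> \<alpha>" and A: "A \<subseteq> {0..\<alpha>}" "0 \<in> A" "1 \<in> A" "\<alpha> - 1 \<in> A" "\<alpha> \<in> A"
    and F: "F \<subseteq> A" "F \<noteq> {}"
    and keys: "\<And>x y. (x, y) \<in> Poly_Mapping.keys f \<Longrightarrow>
      int \<alpha> dvd x + y \<and> (0 \<le> x \<or> (\<exists>a\<in>F. a \<noteq> 0)) \<and> (0 \<le> y \<or> (\<exists>a\<in>F. a \<noteq> \<alpha>))"
  shows "f \<in> localization (semigroup_ring (affine_semigroup \<alpha> A)) (\<Prod>j\<in>F. gen \<alpha> j)"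
  unfolding localization_iff[OF F(1)]
proof
  fix u assume u: "u \<in> Poly_Mapping.keys f"
  obtain x y where [simp]: "u = (x, y)" by (cases u)
  let ?p = "\<Sum>j\<in>F. j" and ?q = "\<Sum>j\<in>F. \<alpha> - j"
  have fin: "finite F" using F(1) A(1) by (meson finite_atLeastAtMost finite_subset)
  have "int \<alpha> dvd x + y" using keys u by simp
  then obtain d where d: "x + y = int \<alpha> * d"
    by (rule dvdE)
  define k where "k = nat \<bar>x\<bar> + nat \<bar>y\<bar> + nat \<bar>d\<bar> + 1 + max_gap (support_poly A)"
  have kx: "0 \<le> int k + x" "0 \<le> int k + y" "1 + int (max_gap (support_poly A)) \<le> int k + d"
    by (simp_all add: k_def)
  have pq: "?p + ?q = card F * \<alpha>"
  proof -
    have "?p + ?q = (\<Sum>j\<in>F. \<alpha>)"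
      unfolding sum.distrib[symmetric] using F(1) A(1) by (intro sum.cong) auto
    then show ?thesis by simp
  qed
  have "0 \<le> int (k * ?p) + x"
  proof (cases "0 \<le> x")
    case False
    then have "?p > 0" using keys[of x y] u fin by (auto simp: sum_nonneg_eq_0_iff intro!: gr0I)
    then have "k \<le> k * ?p" by simp
    then show ?thesis using kx by linarith
  qed (intro add_nonneg_nonneg of_nat_0_le_iff)
  then obtain x' where x': "int (k * ?p) + x = int x'"
    using nonneg_int_cases by blast
  have "0 \<le> int (k * ?q) + y"
  proof (cases "0 \<le> y")
    case False
    then obtain a where "a \<in> F" "a \<noteq> \<alpha>" using keys[of x y] u by auto
    then have "\<alpha> - a > 0" using F(1) A(1) by (metis atLeastAtMost_iff le_neq_implies_less subsetD zero_less_diff)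
    then have "?q > 0" using \<open>a \<in> F\<close> fin by (intro sum_pos2) auto
    then have "k \<le> k * ?q" by simp
    then show ?thesis using kx by linarith
  qed (intro add_nonneg_nonneg of_nat_0_le_iff)
  then obtain y' where y': "int (k * ?q) + y = int y'"
    using nonneg_int_cases by blast
  have "card F \<ge> 1" using F(2) fin by (simp add: Suc_le_eq card_gt_0_iff)
  then have "k \<le> k * card F" by simp
  then have ge: "1 + int (max_gap (support_poly A)) \<le> d + int (k * card F)"
    using kx by linarith
  then obtain D where D: "d + int (k * card F) = int D"
    using nonneg_int_cases[of "d + int (k * card F)"] by force
  have "int (x' + y') = int (D * \<alpha>)"
  proof -
    have "int (x' + y') = (x + y) + int (k * (?p + ?q))"
      using x' y' by (simp add: algebra_simps)
    also have "\<dots> = (d + int (k * card F)) * int \<alpha>"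
      unfolding pq d by (simp add: algebra_simps)
    finally show ?thesis unfolding D by simp
  qed
  then have sum: "x' + y' = D * \<alpha>" by (simp only: of_nat_eq_iff)
  have D1: "1 \<le> D" "max_gap (support_poly A) \<le> D - 1"
    using ge unfolding D by linarith+
  have "D - 1 \<le> (D - 1) * eps \<alpha> A"
    using eps_props(1)[OF assms(1) A(2-5)] by simp
  then have "max_gap (support_poly A) \<le> (D - 1) * eps \<alpha> A"
    using D1(2) by linarith
  then have "(x', y') \<in> affine_semigroup \<alpha> A"
    by (rule affine_semigroup_full_degree[OF assms(1) A D1(1) _ sum])
  then have "map_prod int int (x', y') \<in> map_prod int int ` affine_semigroup \<alpha> A"
    by blast
  then show "\<exists>k. (int (k * ?p), int (k * ?q)) + u \<in> map_prod int int ` affine_semigroup \<alpha> A"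
    using x' y' by (intro exI[of _ k]) simp
qed

lemma localization_bottom_keys:
  assumes "0 \<in> A" "f \<in> localization (semigroup_ring (affine_semigroup \<alpha> A)) (\<Prod>j\<in>{0}. gen \<alpha> j)"
    "(x, y) \<in> Poly_Mapping.keys (f :: (int \<times> int) \<Rightarrow>\<^sub>0 'k::field)"
  shows "0 \<le> x"
proof -
  have "{0} \<subseteq> A" using assms(1) by simp
  from bspec[OF iffD1[OF localization_iff[OF this] assms(2)] assms(3)]
  obtain k s where
    "(int (k * (\<Sum>j\<in>{0}. j)), int (k * (\<Sum>j\<in>{0}. \<alpha> - j))) + (x, y) = map_prod int int s"
    by (elim exE imageE)
  then show ?thesis by (cases s) simp
qed

lemma localization_top_keys:
  assumes "\<alpha> \<in> A" "f \<in> localization (semigroup_ring (affine_semigroup \<alpha> A)) (\<Prod>j\<in>{\<alpha>}. gen \<alpha> j)"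
    "(x, y) \<in> Poly_Mapping.keys (f :: (int \<times> int) \<Rightarrow>\<^sub>0 'k::field)"
  shows "0 \<le> y"
proof -
  have "{\<alpha>} \<subseteq> A" using assms(1) by simp
  from bspec[OF iffD1[OF localization_iff[OF this] assms(2)] assms(3)]
  obtain k s where
    "(int (k * (\<Sum>j\<in>{\<alpha>}. j)), int (k * (\<Sum>j\<in>{\<alpha>}. \<alpha> - j))) + (x, y) = map_prod int int s"
    by (elim exE imageE)
  then show ?thesis by (cases s) simp
qed


section \<open>The Cech complex\<close>

definition cech_cone :: "'i::linorder \<Rightarrow> ('i set \<Rightarrow> 'r::comm_ring_1) \<Rightarrow> 'i set \<Rightarrow> 'r" where
  "cech_cone e z F = (if e \<in> F then 0 else (- 1) ^ card {k\<in>F. k < e} * z (insert e F))"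

lemma minus_one_power_cancel: "(- 1) ^ n * ((- 1) ^ n * (x::'r::comm_ring_1)) = x"
  by (simp add: mult.assoc[symmetric] power_mult_distrib[symmetric])

lemma card_less_insert:
  assumes "finite F" "e \<notin> F"
  shows "card {k \<in> insert e F. k < j} = card {k\<in>F. k < j} + (if e < j then 1 else 0)"
proof -
  have "{k \<in> insert e F. k < j} = (if e < j then insert e {k\<in>F. k < j} else {k\<in>F. k < j})"
    by auto
  then show ?thesis using assms by simp
qed

lemma cech_diff_cone:
  fixes z :: "'i::linorder set \<Rightarrow> 'r::comm_ring_1"
  assumes X: "finite X" "e \<in> X" and z: "cech_diff X z = (\<lambda>F. 0)"
    and supp: "\<And>F. \<not> F \<subseteq> X \<Longrightarrow> z F = 0"
  shows "cech_diff X (cech_cone e z) = z"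
proof
  fix F
  let ?s = "\<lambda>F j. (- 1 :: 'r) ^ card {k\<in>F. k < j}"
  show "cech_diff X (cech_cone e z) F = z F"
  proof (cases "F \<subseteq> X")
    case True
    then have fin: "finite F" using X(1) finite_subset by blast
    show ?thesis
    proof (cases "e \<in> F")
      case eF: True
      have "(\<Sum>j\<in>F. ?s F j * cech_cone e z (F - {j}))
          = (\<Sum>j\<in>{e}. ?s F j * cech_cone e z (F - {j}))"
        using fin eF by (intro sum.mono_neutral_right) (auto simp: cech_cone_def)
      also have "\<dots> = ?s F e * (?s (F - {e}) e * z F)"
        using eF by (simp add: cech_cone_def insert_absorb)
      also have "{k \<in> F - {e}. k < e} = {k\<in>F. k < e}" by auto
      finally show ?thesis using True by (simp add: cech_diff_def minus_one_power_cancel)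
    next
      case eF: False
      have "0 = cech_diff X z (insert e F)" using z by simp
      also have "\<dots> = ?s (insert e F) e * z F + (\<Sum>j\<in>F. ?s (insert e F) j * z (insert e F - {j}))"
        using True X fin eF by (simp add: cech_diff_def)
      also have "?s (insert e F) e = ?s F e"
        using card_less_insert[OF fin eF, of e] by simp
      finally have "?s F e * z F = - (\<Sum>j\<in>F. ?s (insert e F) j * z (insert e F - {j}))"
        by (simp add: eq_neg_iff_add_eq_0)
      then have "z F = ?s F e * (- (\<Sum>j\<in>F. ?s (insert e F) j * z (insert e F - {j})))"
        by (metis minus_one_power_cancel)
      also have "\<dots> = (\<Sum>j\<in>F. ?s F e * - (?s (insert e F) j * z (insert e F - {j})))"
        by (simp add: sum_negf[symmetric] sum_distrib_left)
      also have "\<dots> = (\<Sum>j\<in>F. ?s F j * cech_cone e z (F - {j}))"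
      proof (rule sum.cong[OF refl])
        fix j assume j: "j \<in> F"
        then have "j \<noteq> e" using eF by auto
        have ins: "insert e F - {j} = insert e (F - {j})" using \<open>j \<noteq> e\<close> by auto
        have "card {k\<in>F. k < e} = card {k\<in>F - {j}. k < e} + (if j < e then 1 else 0)"
          using card_less_insert[of "F - {j}" j e] fin j by (simp add: insert_absorb)
        moreover have "card {k\<in>insert e F. k < j} = card {k\<in>F. k < j} + (if e < j then 1 else 0)"
          using card_less_insert[OF fin eF] .
        ultimately show "?s F e * - (?s (insert e F) j * z (insert e F - {j}))
            = ?s F j * cech_cone e z (F - {j})"
          using eF \<open>j \<noteq> e\<close> by (auto simp: cech_cone_def ins not_less_iff_gr_or_eq)
      qed
      finally show ?thesis using True by (simp add: cech_diff_def)
    qed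
  qed (simp add: cech_diff_def supp)
qed

lemma cech_diff_add: "cech_diff X (\<lambda>F. c F + d F) = (\<lambda>F. cech_diff X c F + cech_diff X d F)"
  by (rule ext) (simp add: cech_diff_def sum.distrib distrib_left)

lemma cech_diff_diff:
  assumes "finite X"
  shows "cech_diff X (cech_diff X c) = (\<lambda>F. 0)"
proof
  fix F
  show "cech_diff X (cech_diff X c) F = 0"
  proof (cases "F \<subseteq> X")
    case True
    then have fin: "finite F" using assms finite_subset by blast
    let ?s = "\<lambda>F j. (- 1 :: 'b) ^ card {k\<in>F. k < j}"
    define g where "g j k = ?s F j * (?s (F - {j}) k * c (F - {j} - {k}))" for j k
    have anti: "g k j = - g j k" if "j \<in> F" "k \<in> F" "j < k" for j k
    proof -
      have "card {i\<in>F. i < k} = card {i\<in>F - {j}. i < k} + 1"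
        using card_less_insert[of "F - {j}" j k] fin that by (simp add: insert_absorb)
      moreover have "{i\<in>F - {k}. i < j} = {i\<in>F. i < j}" using that by auto
      moreover have "F - {k} - {j} = F - {j} - {k}" by auto
      ultimately show ?thesis by (simp add: g_def algebra_simps)
    qed
    have "cech_diff X (cech_diff X c) F = (\<Sum>j\<in>F. \<Sum>k\<in>F - {j}. g j k)"
      using True by (auto simp: cech_diff_def g_def sum_distrib_left intro!: sum.cong)
    also have "\<dots> = (\<Sum>j\<in>F. (\<Sum>k\<in>{k\<in>F. j < k}. g j k) + (\<Sum>k\<in>{k\<in>F. k < j}. g j k))"
    proof (rule sum.cong[OF refl])
      fix j assume "j \<in> F"
      have eq: "F - {j} = {k\<in>F. j < k} \<union> {k\<in>F. k < j}" by auto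
      show "(\<Sum>k\<in>F - {j}. g j k) = (\<Sum>k\<in>{k\<in>F. j < k}. g j k) + (\<Sum>k\<in>{k\<in>F. k < j}. g j k)"
        unfolding eq by (rule sum.union_disjoint) (use fin in auto)
    qed
    also have "\<dots> = (\<Sum>j\<in>F. \<Sum>k\<in>{k\<in>F. j < k}. g j k) + (\<Sum>j\<in>F. \<Sum>k\<in>{k\<in>F. k < j}. g j k)"
      by (rule sum.distrib)
    also have "(\<Sum>j\<in>F. \<Sum>k\<in>{k\<in>F. k < j}. g j k) = (\<Sum>k\<in>F. \<Sum>j\<in>{j\<in>F. k < j}. g j k)"
      using fin by (rule sum.swap_restrict[OF _ fin])
    also have "\<dots> = (\<Sum>j\<in>F. \<Sum>k\<in>{k\<in>F. j < k}. - g j k)"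
      using anti by (intro sum.cong) auto
    finally show ?thesis by (simp add: sum_negf)
  qed (simp add: cech_diff_def)
qed

lemma cech_diff_zero: "cech_diff X (\<lambda>F. 0) = (\<lambda>F. 0)"
  by (rule ext) (simp add: cech_diff_def)

lemma zero_in_cochains:
  assumes "0 \<in> R"
  shows "(\<lambda>F. 0) \<in> cech_cochains R x X i"
proof -
  have "0 \<in> localization R s" for s
    using assms by (simp add: localization_def)
  then show ?thesis by (simp add: cech_cochains_def)
qed

lemma zero_in_cocycles: "0 \<in> R \<Longrightarrow> (\<lambda>F. 0) \<in> cech_cocycles R x X i"
  by (simp add: cech_cocycles_def zero_in_cochains cech_diff_zero)

lemma zero_in_coboundaries:
  assumes "0 \<in> R"
  shows "(\<lambda>F. 0) \<in> cech_coboundaries R x X i"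
proof (cases i)
  case (Suc i')
  show ?thesis
    unfolding Suc cech_coboundaries.simps
    by (rule image_eqI[where x = "\<lambda>F. 0"]) (simp_all add: cech_diff_zero zero_in_cochains assms)
qed simp

lemma cech_diff_minus: "cech_diff X (\<lambda>F. c F - d F) = (\<lambda>F. cech_diff X c F - cech_diff X d F)"
  by (rule ext) (simp add: cech_diff_def sum_subtractf right_diff_distrib)

lemma cech_cochains_minus:
  fixes c d :: "nat set \<Rightarrow> (int \<times> int) \<Rightarrow>\<^sub>0 'k::field"
    and \<alpha> :: nat and A :: "nat set"
  defines "R \<equiv> semigroup_ring (affine_semigroup \<alpha> A)"
  assumes "c \<in> cech_cochains R (gen \<alpha>) A i" "d \<in> cech_cochains R (gen \<alpha>) A i"
  shows "(\<lambda>F. c F - d F) \<in> cech_cochains R (gen \<alpha>) A i"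
proof -
  have loc: "f - g \<in> localization R (\<Prod>j\<in>F. gen \<alpha> j)"
    if F: "F \<subseteq> A" and fg: "f \<in> localization R (\<Prod>j\<in>F. gen \<alpha> j)" "g \<in> localization R (\<Prod>j\<in>F. gen \<alpha> j)"
    for F and f g :: "(int \<times> int) \<Rightarrow>\<^sub>0 'k"
    unfolding R_def localization_iff[OF F]
  proof
    fix u assume "u \<in> Poly_Mapping.keys (f - g)"
    then have "u \<in> Poly_Mapping.keys f \<or> u \<in> Poly_Mapping.keys g"
      using keys_diff[of f g] by blast
    then show "\<exists>k. (int (k * (\<Sum>j\<in>F. j)), int (k * (\<Sum>j\<in>F. \<alpha> - j))) + u
        \<in> map_prod int int ` affine_semigroup \<alpha> A"
      using fg[unfolded R_def localization_iff[OF F]] by (elim disjE) (drule (1) bspec; assumption)+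
  qed
  have "if F \<subseteq> A \<and> card F = i then c F - d F \<in> localization R (\<Prod>j\<in>F. gen \<alpha> j) else c F - d F = 0" for F
    using assms(2,3)[unfolded cech_cochains_def mem_Collect_eq, rule_format, of F]
    by (auto intro: loc split: if_splits)
  then show ?thesis by (simp add: cech_cochains_def)
qed

lemma cech_coboundaries_minus:
  fixes z w :: "nat set \<Rightarrow> (int \<times> int) \<Rightarrow>\<^sub>0 'k::field"
    and \<alpha> :: nat and A :: "nat set"
  defines "R \<equiv> semigroup_ring (affine_semigroup \<alpha> A)"
  assumes "z \<in> cech_coboundaries R (gen \<alpha>) A i" "w \<in> cech_coboundaries R (gen \<alpha>) A i"
  shows "(\<lambda>F. z F - w F) \<in> cech_coboundaries R (gen \<alpha>) A i"
proof (cases i)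
  case (Suc i')
  then obtain c d where cd: "c \<in> cech_cochains R (gen \<alpha>) A i'" "d \<in> cech_cochains R (gen \<alpha>) A i'"
    "z = cech_diff A c" "w = cech_diff A d"
    using assms(2,3) by auto
  have "(\<lambda>F. z F - w F) = cech_diff A (\<lambda>F. c F - d F)"
    unfolding cech_diff_minus cd(3,4) ..
  moreover have "(\<lambda>F. c F - d F) \<in> cech_cochains R (gen \<alpha>) A i'"
    using cd(1,2) unfolding R_def by (rule cech_cochains_minus)
  ultimately show ?thesis unfolding Suc cech_coboundaries.simps by (rule image_eqI)
qed (use assms(2,3) in simp)

lemma local_cohomology_component_trivial:
  fixes \<alpha> :: nat and A :: "nat set"
  defines "R \<equiv> semigroup_ring (affine_semigroup \<alpha> A) :: ((int \<times> int) \<Rightarrow>\<^sub>0 'k::field) set"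
  assumes van: "\<And>z. z \<in> cech_cocycles R (gen \<alpha>) A i \<Longrightarrow> \<forall>F. z F \<in> homogeneous \<alpha> d
      \<Longrightarrow> z \<in> cech_coboundaries R (gen \<alpha>) A i"
  shows "local_cohomology_component (homogeneous \<alpha>) R (gen \<alpha>) A i d
    = {cohomologous R (gen \<alpha>) A i `` {\<lambda>F. 0}}"
proof -
  let ?Z = "cech_cocycles R (gen \<alpha>) A i" and ?B = "cech_coboundaries R (gen \<alpha>) A i"
    and ?r = "cohomologous R (gen \<alpha>) A i"
  have R0: "0 \<in> R" by (simp add: R_def semigroup_ring_def)
  have Z0: "(\<lambda>F. 0) \<in> ?Z" and B0: "(\<lambda>F. 0) \<in> ?B"
    using zero_in_cocycles[OF R0] zero_in_coboundaries[OF R0] .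
  have minus: "(\<lambda>F. a F - b F) \<in> ?B" if "a \<in> ?B" "b \<in> ?B" for a b
    using that unfolding R_def by (rule cech_coboundaries_minus)
  have cls: "?r `` {w} = ?r `` {\<lambda>F. 0}" if w: "w \<in> ?Z" "w \<in> ?B" for w
  proof (intro set_eqI iffI)
    fix v assume "v \<in> ?r `` {w}"
    then have v: "v \<in> ?Z" "(\<lambda>F. w F - v F) \<in> ?B" by (auto simp: cohomologous_def)
    from minus[OF v(2) w(2)] show "v \<in> ?r `` {\<lambda>F. 0}"
      using v(1) Z0 by (simp add: cohomologous_def)
  next
    fix v assume "v \<in> ?r `` {\<lambda>F. 0}"
    then have v: "v \<in> ?Z" "(\<lambda>F. 0 - v F) \<in> ?B" by (auto simp: cohomologous_def)
    from minus[OF v(2) minus[OF B0 w(2)]] show "v \<in> ?r `` {w}"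
      using v(1) w(1) by (simp add: cohomologous_def)
  qed
  show ?thesis
  proof (intro set_eqI iffI)
    fix H assume "H \<in> local_cohomology_component (homogeneous \<alpha>) R (gen \<alpha>) A i d"
    then obtain z w where H: "H = ?r `` {w}" "z \<in> H" "\<forall>F. z F \<in> homogeneous \<alpha> d"
      by (auto simp: local_cohomology_component_def local_cohomology_def elim!: quotientE)
    then have w: "w \<in> ?Z" "z \<in> ?Z" "(\<lambda>F. w F - z F) \<in> ?B" by (auto simp: cohomologous_def)
    have "z \<in> ?B" using van w(2) H(3) by blast
    from minus[OF w(3) minus[OF B0 this]] have "w \<in> ?B" by simp
    then show "H \<in> {?r `` {\<lambda>F. 0}}" using cls w(1) H(1) by simp
  next
    fix H assume "H \<in> {?r `` {\<lambda>F. 0}}"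
    then have H: "H = ?r `` {\<lambda>F. 0}" by simp
    have "(\<lambda>F. 0) \<in> H" using H Z0 B0 by (simp add: cohomologous_def)
    moreover have "\<forall>F. 0 \<in> homogeneous \<alpha> d" by (simp add: homogeneous_def)
    moreover have "H \<in> ?Z // ?r" unfolding H using Z0 by (rule quotientI)
    ultimately show "H \<in> local_cohomology_component (homogeneous \<alpha>) R (gen \<alpha>) A i d"
      unfolding local_cohomology_component_def local_cohomology_def by fast
  qed
qed


section \<open>Vanishing and nonvanishing\<close>

definition restrict_keys :: "('a \<Rightarrow> bool) \<Rightarrow> ('a \<Rightarrow>\<^sub>0 'b::zero) \<Rightarrow> ('a \<Rightarrow>\<^sub>0 'b)" where
  "restrict_keys P f = Poly_Mapping.mapp (\<lambda>u v. v when P u) f"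

lemma lookup_restrict_keys:
  "Poly_Mapping.lookup (restrict_keys P f) u = (Poly_Mapping.lookup f u when P u)"
  by (cases "u \<in> Poly_Mapping.keys f") (simp_all add: restrict_keys_def lookup_mapp in_keys_iff)

lemma keys_restrict_keys: "Poly_Mapping.keys (restrict_keys P f) = {u \<in> Poly_Mapping.keys f. P u}"
  by (auto simp: in_keys_iff lookup_restrict_keys)

lemma restrict_keys_zero: "restrict_keys P 0 = 0"
  by (rule poly_mapping_eqI) (simp add: lookup_restrict_keys)

lemma restrict_keys_add: "restrict_keys P (f + g) = restrict_keys P f + restrict_keys P g"
  by (rule poly_mapping_eqI) (simp add: lookup_restrict_keys lookup_add when_add_distrib)

lemma restrict_keys_uminus:
  "restrict_keys P (- f) = - restrict_keys P (f :: 'a \<Rightarrow>\<^sub>0 'b::ab_group_add)"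
  by (rule poly_mapping_eqI) (simp add: lookup_restrict_keys when_def)

lemma restrict_keys_sum: "restrict_keys P (\<Sum>j\<in>J. f j) = (\<Sum>j\<in>J. restrict_keys P (f j))"
  by (induction J rule: infinite_finite_induct) (simp_all add: restrict_keys_zero restrict_keys_add)

lemma restrict_keys_complement: "restrict_keys P f + restrict_keys (\<lambda>u. \<not> P u) f = f"
  by (rule poly_mapping_eqI) (simp add: lookup_restrict_keys lookup_add when_def)

lemma restrict_keys_sign:
  "restrict_keys P ((- 1) ^ n * f) = (- 1) ^ n * restrict_keys P (f :: 'a::monoid_add \<Rightarrow>\<^sub>0 'b::comm_ring_1)"
  by (cases "even n") (simp_all add: restrict_keys_uminus)

lemma keys_sign:
  "Poly_Mapping.keys ((- 1) ^ n * f) = Poly_Mapping.keys (f :: 'a::monoid_add \<Rightarrow>\<^sub>0 'b::comm_ring_1)"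
  by (cases "even n") simp_all

lemma cech_diff_restrict_keys:
  fixes z :: "'i::linorder set \<Rightarrow> ('a::comm_monoid_add \<Rightarrow>\<^sub>0 'b::comm_ring_1)"
  shows "cech_diff X (\<lambda>F. restrict_keys P (z F)) = (\<lambda>F. restrict_keys P (cech_diff X z F))"
  by (auto simp: cech_diff_def fun_eq_iff restrict_keys_zero restrict_keys_sum restrict_keys_sign)

lemma keys_cech_cone:
  fixes z :: "'i::linorder set \<Rightarrow> ('a::comm_monoid_add \<Rightarrow>\<^sub>0 'b::comm_ring_1)"
  shows "Poly_Mapping.keys (cech_cone e z F) = (if e \<in> F then {} else Poly_Mapping.keys (z (insert e F)))"
  by (simp add: cech_cone_def keys_sign)

text \<open>The contracting homotopy is chosen monomial by monomial: the cone over the vertex \<open>\<alpha>\<close> where the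
  first exponent is nonnegative, and over the vertex \<open>0\<close> elsewhere.\<close>

lemma cocycle_is_coboundary:
  fixes z :: "nat set \<Rightarrow> (int \<times> int) \<Rightarrow>\<^sub>0 'k::field"
    and \<alpha> :: nat and A :: "nat set"
  defines "R \<equiv> semigroup_ring (affine_semigroup \<alpha> A)"
  assumes \<alpha>: "2 \<le> \<alpha>" and A: "A \<subseteq> {0..\<alpha>}" "0 \<in> A" "1 \<in> A" "\<alpha> - 1 \<in> A" "\<alpha> \<in> A"
    and z: "z \<in> cech_cocycles R (gen \<alpha>) A i" and hom: "\<forall>F. z F \<in> homogeneous \<alpha> d"
    and i1: "i = 1 \<Longrightarrow> 1 \<le> d \<and> max_gap (support_poly A) \<le> (nat d - 1) * eps \<alpha> A"
    and i2: "i = 2 \<Longrightarrow> 0 \<le> d"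
  shows "z \<in> cech_coboundaries R (gen \<alpha>) A i"
proof -
  have finA: "finite A" using A(1) finite_subset by blast
  have zc: "if F \<subseteq> A \<and> card F = i then z F \<in> localization R (\<Prod>j\<in>F. gen \<alpha> j) else z F = 0" for F
    using z unfolding cech_cocycles_def cech_cochains_def by blast
  have dz: "cech_diff A z = (\<lambda>F. 0)"
    using z by (simp add: cech_cocycles_def)
  show ?thesis
  proof (cases i)
    case 0
    have "z F = 0" for F
    proof (cases "F = {}")
      case True
      have "cech_diff A z {0} = z {}"
        using A(2) by (simp add: cech_diff_def)
      then show ?thesis using dz True by simp
    next
      case False
      then show ?thesis using zc[of F] 0 finA finite_subset[of F A] by (auto split: if_splits)
    qed
    then show ?thesis using 0 by auto
  next
    case (Suc n)
    define P where "P u \<longleftrightarrow> 0 \<le> fst u" for u :: "int \<times> int"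
    define z1 where "z1 = (\<lambda>F. restrict_keys P (z F))"
    define z2 where "z2 = (\<lambda>F. restrict_keys (\<lambda>u. \<not> P u) (z F))"
    define c where "c F = cech_cone \<alpha> z1 F + cech_cone 0 z2 F" for F
    have supp: "z F = 0" if "\<not> F \<subseteq> A" for F using zc[of F] that by simp
    have "cech_diff A (cech_cone \<alpha> z1) = z1"
      using finA A(5)
      by (rule cech_diff_cone) (simp_all add: z1_def cech_diff_restrict_keys dz restrict_keys_zero supp)
    moreover have "cech_diff A (cech_cone 0 z2) = z2"
      using finA A(2)
      by (rule cech_diff_cone) (simp_all add: z2_def cech_diff_restrict_keys dz restrict_keys_zero supp)
    ultimately have zeq: "z = cech_diff A c"
      unfolding c_def cech_diff_add by (simp add: z1_def z2_def restrict_keys_complement)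
    have keysc: "(0 \<le> x \<and> \<alpha> \<notin> F \<and> (x, y) \<in> Poly_Mapping.keys (z (insert \<alpha> F)))
        \<or> (x < 0 \<and> 0 \<notin> F \<and> (x, y) \<in> Poly_Mapping.keys (z (insert 0 F)))"
      if "(x, y) \<in> Poly_Mapping.keys (c F)" for x y F
      using subsetD[OF keys_add that[unfolded c_def]]
      by (auto simp: keys_cech_cone z1_def z2_def keys_restrict_keys P_def split: if_splits)
    have deg: "x + y = d * int \<alpha>" if "(x, y) \<in> Poly_Mapping.keys (z F)" for x y F
      using hom that by (fastforce simp: homogeneous_def)
    have loc: "c F \<in> localization R (\<Prod>j\<in>F. gen \<alpha> j)" if F: "F \<subseteq> A" "card F = n" for F
    proof (cases "F = {}")
      case True
      then have n: "n = 0" using F(2) by simp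
      have "u \<in> map_prod int int ` affine_semigroup \<alpha> A" if u: "u \<in> Poly_Mapping.keys (c {})" for u
      proof -
        obtain x y where xy: "u = (x, y)" by (cases u)
        have z0: "z {0} \<in> localization R (\<Prod>j\<in>{0}. gen \<alpha> j)"
          using zc[of "{0}"] A Suc n by simp
        have za: "z {\<alpha>} \<in> localization R (\<Prod>j\<in>{\<alpha>}. gen \<alpha> j)"
          using zc[of "{\<alpha>}"] A Suc n by simp
        have x: "0 \<le> x" "(x, y) \<in> Poly_Mapping.keys (z {\<alpha>})"
          using keysc[of x y "{}"] localization_bottom_keys[OF A(2) z0[unfolded R_def], of x y] u
          by (auto simp: xy)
        have y: "0 \<le> y"
          using localization_top_keys[OF A(5) za[unfolded R_def] x(2)] .
        have d: "1 \<le> d" "max_gap (support_poly A) \<le> (nat d - 1) * eps \<alpha> A"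
          using i1 Suc n by auto
        have "int (nat x + nat y) = int (nat d * \<alpha>)"
          using deg[OF x(2)] x(1) y d(1) by simp
        then have "nat x + nat y = nat d * \<alpha>" by (simp only: of_nat_eq_iff)
        then have "(nat x, nat y) \<in> affine_semigroup \<alpha> A"
          using d by (intro affine_semigroup_full_degree[OF \<alpha> A, where d = "nat d"]) auto
        then have "map_prod int int (nat x, nat y) \<in> map_prod int int ` affine_semigroup \<alpha> A"
          by (rule imageI)
        then show ?thesis using x(1) y by (simp add: xy)
      qed
      then have "c {} \<in> R"
        unfolding R_def semigroup_ring_def by blast
      then show ?thesis
        using True by (simp add: localization_def)
    next
      case False
      show ?thesis
        unfolding R_def
      proof (rule in_localization[OF \<alpha> A F(1) False])
        fix x y assume xy: "(x, y) \<in> Poly_Mapping.keys (c F)"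
        have d: "x + y = d * int \<alpha>" using keysc[OF xy] deg by blast
        have "(0 \<le> x \<or> (\<exists>a\<in>F. a \<noteq> 0)) \<and> (0 \<le> y \<or> (\<exists>a\<in>F. a \<noteq> \<alpha>))"
        proof (cases "0 \<le> x")
          case True
          then have "\<alpha> \<notin> F" using keysc[OF xy] by auto
          then show ?thesis using True False by auto
        next
          case neg: False
          then have "0 \<notin> F" using keysc[OF xy] by auto
          then have "\<exists>a\<in>F. a \<noteq> 0" using False by auto
          moreover have "0 \<le> y \<or> (\<exists>a\<in>F. a \<noteq> \<alpha>)"
          proof (rule ccontr)
            assume *: "\<not> ?thesis"
            then have "F = {\<alpha>}" using False by auto
            then have "0 \<le> d" using i2 Suc F(2) by simp
            then have "0 \<le> x + y" unfolding d by simp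
            then show False using * neg by simp
          qed
          ultimately show ?thesis by blast
        qed
        then show "int \<alpha> dvd x + y \<and> (0 \<le> x \<or> (\<exists>a\<in>F. a \<noteq> 0)) \<and> (0 \<le> y \<or> (\<exists>a\<in>F. a \<noteq> \<alpha>))"
          unfolding d by simp
      qed
    qed
    have zero: "c F = 0" if F: "\<not> (F \<subseteq> A \<and> card F = n)" for F
    proof -
      have ins: "e \<in> F \<or> z (insert e F) = 0" if "e \<in> A" for e
      proof (cases "F \<subseteq> A")
        case True
        then have "finite F" using finA finite_subset by blast
        then show ?thesis using zc[of "insert e F"] F True Suc by (cases "e \<in> F") simp_all
      next
        case False
        then show ?thesis using supp[of "insert e F"] by simp
      qed
      show ?thesis
        using ins[OF A(2)] ins[OF A(5)]
        by (auto simp: c_def cech_cone_def z1_def z2_def restrict_keys_zero)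
    qed
    have "c \<in> cech_cochains R (gen \<alpha>) A n"
      unfolding cech_cochains_def using loc zero by simp
    then show ?thesis
      unfolding Suc cech_coboundaries.simps using zeq by blast
  qed
qed

lemma second_cohomology_nontrivial:
  fixes \<alpha> :: nat and A :: "nat set"
  defines "R \<equiv> semigroup_ring (affine_semigroup \<alpha> A) :: ((int \<times> int) \<Rightarrow>\<^sub>0 'k::field) set"
  assumes \<alpha>: "2 \<le> \<alpha>" and A: "A \<subseteq> {0..\<alpha>}" "0 \<in> A" "1 \<in> A" "\<alpha> - 1 \<in> A" "\<alpha> \<in> A"
  shows "local_cohomology_component (homogeneous \<alpha>) R (gen \<alpha>) A 2 (- 1)
    \<noteq> {cohomologous R (gen \<alpha>) A 2 `` {\<lambda>F. 0}}"
proof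
  let ?Z = "cech_cocycles R (gen \<alpha>) A 2" and ?B = "cech_coboundaries R (gen \<alpha>) A 2"
    and ?r = "cohomologous R (gen \<alpha>) A 2"
  assume triv: "local_cohomology_component (homogeneous \<alpha>) R (gen \<alpha>) A 2 (- 1) = {?r `` {\<lambda>F. 0}}"
  have finA: "finite A" using A(1) finite_subset by blast
  define u where "u = (- 1 :: int, 1 - int \<alpha>)"
  define c where "c F = (if F = {\<alpha>} then Poly_Mapping.single u (1::'k) else 0)" for F :: "nat set"
  define z where "z = cech_diff A c"
  have keysz: "v = u \<and> F \<subseteq> A \<and> (\<exists>j. j \<noteq> \<alpha> \<and> F = {j, \<alpha>})" if v: "v \<in> Poly_Mapping.keys (z F)" for v F
  proof -
    have F: "F \<subseteq> A" using v by (auto simp: z_def cech_diff_def split: if_splits)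
    then have "v \<in> Poly_Mapping.keys (\<Sum>j\<in>F. (- 1) ^ card {k\<in>F. k < j} * c (F - {j}))"
      using v by (simp add: z_def cech_diff_def)
    then obtain j where j: "j \<in> F" "v \<in> Poly_Mapping.keys (c (F - {j}))"
      using subsetD[OF keys_sum] by (force simp: keys_sign)
    then have "F - {j} = {\<alpha>}" "v = u" by (auto simp: c_def split: if_splits)
    then show ?thesis using F j(1) by auto
  qed
  have "if F \<subseteq> A \<and> card F = 2 then z F \<in> localization R (\<Prod>j\<in>F. gen \<alpha> j) else z F = 0" for F
  proof (cases "F \<subseteq> A \<and> card F = 2")
    case True
    then have "F \<noteq> {}" by auto
    have "z F \<in> localization R (\<Prod>j\<in>F. gen \<alpha> j)"
      unfolding R_def
    proof (rule in_localization[OF \<alpha> A conjunct1[OF True] \<open>F \<noteq> {}\<close>])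
      fix x y assume "(x, y) \<in> Poly_Mapping.keys (z F)"
      from keysz[OF this] \<alpha>
      show "int \<alpha> dvd x + y \<and> (0 \<le> x \<or> (\<exists>a\<in>F. a \<noteq> 0)) \<and> (0 \<le> y \<or> (\<exists>a\<in>F. a \<noteq> \<alpha>))"
        by (auto simp: u_def)
    qed
    then show ?thesis using True by simp
  next
    case False
    then have "Poly_Mapping.keys (z F) = {}" using keysz[of _ F] by fastforce
    then show ?thesis using False by auto
  qed
  then have zZ: "z \<in> ?Z"
    unfolding cech_cocycles_def cech_cochains_def z_def using cech_diff_diff[OF finA] by blast
  have hom: "\<forall>F. z F \<in> homogeneous \<alpha> (- 1)"
    unfolding homogeneous_def using keysz by (fastforce simp: u_def)
  have R0: "0 \<in> R" by (simp add: R_def semigroup_ring_def)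
  have "(\<lambda>F. z F - z F) \<in> ?B"
    using zero_in_coboundaries[OF R0] by simp
  then have zz: "z \<in> ?r `` {z}" using zZ by (simp add: cohomologous_def)
  have "?r `` {z} \<in> ?Z // ?r" using zZ by (rule quotientI)
  then have "?r `` {z} \<in> local_cohomology_component (homogeneous \<alpha>) R (gen \<alpha>) A 2 (- 1)"
    unfolding local_cohomology_component_def local_cohomology_def using zz hom by blast
  then have "z \<in> ?r `` {\<lambda>F. 0}" using triv zz by simp
  then have "(\<lambda>F. 0 - z F) \<in> cech_coboundaries R (gen \<alpha>) A (Suc 1)"
    by (simp add: cohomologous_def numeral_2_eq_2)
  then obtain c' where c': "c' \<in> cech_cochains R (gen \<alpha>) A 1" "(\<lambda>F. 0 - z F) = cech_diff A c'"
    unfolding cech_coboundaries.simps by blast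
  have val: "cech_diff A b {0, \<alpha>} = b {\<alpha>} - b {0}" for b :: "nat set \<Rightarrow> (int \<times> int) \<Rightarrow>\<^sub>0 'k"
  proof -
    have s: "{k. (k = 0 \<or> k = \<alpha>) \<and> k < \<alpha>} = {0}" "{0, \<alpha>} - {0} = {\<alpha>}" "{0, \<alpha>} - {\<alpha>} = {0}"
      using \<alpha> by auto
    show ?thesis
      using A(2,5) \<alpha> s by (simp add: cech_diff_def)
  qed
  have loc: "c' {a} \<in> localization R (\<Prod>j\<in>{a}. gen \<alpha> j)" if "a \<in> A" for a
    using c'(1)[unfolded cech_cochains_def mem_Collect_eq, rule_format, of "{a}"] that by simp
  have "u \<notin> Poly_Mapping.keys (c' {0})"
    using localization_bottom_keys[OF A(2) loc[OF A(2), unfolded R_def], of "- 1" "1 - int \<alpha>"]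
    by (auto simp: u_def)
  moreover have "u \<notin> Poly_Mapping.keys (c' {\<alpha>})"
    using localization_top_keys[OF A(5) loc[OF A(5), unfolded R_def], of "- 1" "1 - int \<alpha>"] \<alpha>
    by (auto simp: u_def)
  ultimately have "Poly_Mapping.lookup (cech_diff A c' {0, \<alpha>}) u = 0"
    by (simp add: val lookup_minus in_keys_iff)
  moreover have "cech_diff A c' {0, \<alpha>} = - Poly_Mapping.single u 1"
    using fun_cong[OF c'(2), of "{0, \<alpha>}"] \<alpha> by (simp add: z_def val c_def)
  ultimately show False by simp
qed

text \<open>\<open>LEAST\<close> over the integers exists only for predicates that are bounded below.\<close>

lemma int_Least_le:
  fixes P :: "int \<Rightarrow> bool"
  assumes "P b" and "\<And>n. P n \<Longrightarrow> 0 < n"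
  shows "(LEAST n. P n) \<le> b"
proof -
  let ?m = "LEAST k. P (int k)"
  have nat: "int (nat n) = n" if "P n" for n using assms(2)[OF that] by simp
  have "P (int ?m)" using assms(1) nat[OF assms(1)] by (metis LeastI)
  moreover have le: "int ?m \<le> n" if "P n" for n
    using Least_le[of "\<lambda>k. P (int k)" "nat n"] nat[OF that] that by (metis of_nat_le_iff)
  ultimately have "(LEAST n. P n) = int ?m" by (intro Least_equality)
  then show ?thesis using le[OF assms(1)] by simp
qed

theorem theorem3p7:
  fixes \<alpha> :: nat and A :: "nat set"
  assumes "2 \<le> \<alpha>"
    and "A \<subseteq> {0..\<alpha>}"
    and "0 \<in> A" and "1 \<in> A" and "\<alpha> - 1 \<in> A" and "\<alpha> \<in> A"
  shows "reg_semigroup_ring TYPE('k::field) \<alpha> A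
    \<le> \<lfloor>(real (max_gap (support_poly A)) - 1) / real (eps \<alpha> A)\<rfloor> + 2"
proof -
  let ?R = "semigroup_ring (affine_semigroup \<alpha> A) :: ((int \<times> int) \<Rightarrow>\<^sub>0 'k) set"
  let ?g = "max_gap (support_poly A)" and ?e = "eps \<alpha> A"
  let ?q = "\<lfloor>(real ?g - 1) / real ?e\<rfloor>"
  let ?P = "\<lambda>n. \<forall>(i::nat) (j::int). n < j \<longrightarrow>
    local_cohomology_component (homogeneous \<alpha>) ?R (gen \<alpha>) A i (j - int i)
      = {cohomologous ?R (gen \<alpha>) A i `` {\<lambda>F. 0}}"
  have e: "1 \<le> ?e" by (rule eps_props(1)[OF assms(1,3-6)])
  have "- 1 \<le> (real ?g - 1) / real ?e" using e by (simp add: pos_le_divide_eq)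
  then have q: "- 1 \<le> ?q" by (simp add: le_floor_iff)
  have full: "?g \<le> (nat d - 1) * ?e" if d: "?q + 2 \<le> d" for d
  proof -
    have "(real ?g - 1) / real ?e < real_of_int ?q + 1" by linarith
    also have "\<dots> \<le> real_of_int (d - 1)" using d by linarith
    also have "\<dots> = real (nat d - 1)" using d q by simp
    finally have "real ?g - 1 < real (nat d - 1) * real ?e"
      using e by (simp add: pos_divide_less_eq)
    then have "real ?g < real ((nat d - 1) * ?e + 1)" by simp
    then show ?thesis unfolding of_nat_less_iff by simp
  qed
  have "?P (?q + 2)"
  proof (intro allI impI)
    fix i :: nat and j :: int assume j: "?q + 2 < j"
    show "local_cohomology_component (homogeneous \<alpha>) ?R (gen \<alpha>) A i (j - int i)
        = {cohomologous ?R (gen \<alpha>) A i `` {\<lambda>F. 0}}"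
    proof (rule local_cohomology_component_trivial)
      fix z assume "z \<in> cech_cocycles ?R (gen \<alpha>) A i" "\<forall>F. z F \<in> homogeneous \<alpha> (j - int i)"
      then show "z \<in> cech_coboundaries ?R (gen \<alpha>) A i"
        by (rule cocycle_is_coboundary[OF assms]) (use j q full in auto)
    qed
  qed
  moreover have "0 < n" if n: "?P n" for n
  proof (rule ccontr)
    assume "\<not> 0 < n"
    then have "n < 1" by simp
    from n[rule_format, OF this, of 2] second_cohomology_nontrivial[OF assms, where 'k = 'k]
    show False by simp
  qed
  ultimately show ?thesis
    unfolding reg_semigroup_ring_def regularity_def by (rule int_Least_le)
qed

end
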